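(* Let $\Xi_F=(S,\mathrm{wt})$ be a full passport with $|S|=N\ge 2$. Then the number of positive tree permutations of $\Xi_F$ is \[ |\mathbf{PT}_+(\Xi_F)| = \sum_{\mathfrak{p}\in\mathfrak{P}(\Xi_F)} (-1)^{|\mathfrak{p}|-1}(N-1)^{|\mathfrak{p}|-1} X(\mathfrak{p}). \]
   Context: A full passport $\Xi_F=(S,\mathrm{wt})$ consists of a finite set $S$ and a function $\mathrm{wt}:S\to\mathbb{R}\setminus\{0\}$ with $\sum_{s\in S}\mathrm{wt}(s)=0$. For a nonempty $S'\subseteq S$ with $\sum_{s\in S'}\mathrm{wt}(s)=0$, the subpassport $\Xi(S')$ is $(S',\mathrm{wt}|_{S'})$. A partition of $\Xi_F$ is a set $\mathfrak{p}=\{\Xi(S_1),\dots,\Xi(S_n)\}$ of subpassports with $S=\bigsqcup_i S_i$, each $S_i$ nonempty of zero weight sum; $|\mathfrak{p}|=n$ and $X(\mathfrak{p})=\prod_{i=1}^n(|S_i|-1)!$; $\mathfrak{P}(\Xi_F)$ is the set of all partitions. A permutation of $\Xi_F$ is a sequence $(s_1,\dots,s_N)$ listing each element of $S$ once, with cumulative sums $H_0=0$, $H_i=\sum_{j=1}^i\mathrm{wt}(s_j)$ (so $H_N=0$). It is positive if $H_i>0$ for all $1\le i\le N-1$. It is a tree permutation if (1) $H_i\neq 0$ for all $1\le i\le N-1$; (2) whenever $1\le k<l\le N$ and $H_{k-1}=H_l>0$, then $\min\{H_k,\dots,H_{l-1}\}<H_{k-1}$; (3) whenever $1\le k<l\le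 N$ and $H_{k-1}=H_l<0$, then $\max\{H_k,\dots,H_{l-1}\}>H_{k-1}$. $\mathbf{PT}_+(\Xi_F)$ is the set of permutations that are both positive and tree permutations. *)

theory Defs
  imports Complex_Main "HOL-Library.Disjoint_Sets" "HOL-Combinatorics.Multiset_Permutations"
begin

definition full_passport :: "'a set \<Rightarrow> ('a \<Rightarrow> real) \<Rightarrow> bool" where
  "full_passport S wt \<longleftrightarrow> finite S \<and> (\<forall>s\<in>S. wt s \<noteq> 0) \<and> (\<Sum>s\<in>S. wt s) = 0"

(* A subpassport (S', wt restricted to S') is determined by its underlying set S',
   so it is represented by S', and a partition of the passport by its set of blocks. *)
definition subpassport :: "'a set \<Rightarrow> ('a \<Rightarrow> real) \<Rightarrow> 'a set \<Rightarrow> bool" where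
  "subpassport S wt S' \<longleftrightarrow> S' \<subseteq> S \<and> S' \<noteq> {} \<and> (\<Sum>s\<in>S'. wt s) = 0"

definition passport_partitions :: "'a set \<Rightarrow> ('a \<Rightarrow> real) \<Rightarrow> 'a set set set" where
  "passport_partitions S wt = {p. partition_on S p \<and> (\<forall>B\<in>p. subpassport S wt B)}"

definition partition_X :: "'a set set \<Rightarrow> nat" where
  "partition_X p = (\<Prod>B\<in>p. fact (card B - 1))"

(* Permutations of S are the lists in permutations_of_set S; s_j is the entry xs ! (j - 1). *)
definition cumulative_sum :: "('a \<Rightarrow> real) \<Rightarrow> 'a list \<Rightarrow> nat \<Rightarrow> real" where
  "cumulative_sum wt xs i = (\<Sum>j = 1..i. wt (xs ! (j - 1)))"

definition positive_permutation :: "('a \<Rightarrow> real) \<Rightarrow> 'a list \<Rightarrow> bool" where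
  "positive_permutation wt xs \<longleftrightarrow>
     (\<forall>i. 1 \<le> i \<and> i \<le> length xs - 1 \<longrightarrow> cumulative_sum wt xs i > 0)"

definition tree_permutation :: "('a \<Rightarrow> real) \<Rightarrow> 'a list \<Rightarrow> bool" where
  "tree_permutation wt xs \<longleftrightarrow>
     (let N = length xs; H = cumulative_sum wt xs in
        (\<forall>i. 1 \<le> i \<and> i \<le> N - 1 \<longrightarrow> H i \<noteq> 0) \<and>
        (\<forall>k l. 1 \<le> k \<and> k < l \<and> l \<le> N \<and> H (k - 1) = H l \<and> H l > 0
           \<longrightarrow> Min (H ` {k..l - 1}) < H (k - 1)) \<and>
        (\<forall>k l. 1 \<le> k \<and> k < l \<and> l \<le> N \<and> H (k - 1) = H l \<and> H l < 0
           \<longrightarrow> Max (H ` {k..l - 1}) > H (k - 1)))"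

definition PT_plus :: "'a set \<Rightarrow> ('a \<Rightarrow> real) \<Rightarrow> 'a list set" where
  "PT_plus S wt =
     {xs \<in> permutations_of_set S. positive_permutation wt xs \<and> tree_permutation wt xs}"

end

(* Lists are read as height paths. Write X(A) = (|A| - 1)! for zero-sum A and
   e_t(S) = sum over partitions p of t^|p| X(p), so that e_(s+t) = e_s * e_t for the convolution
   over subsets.
   Cutting a cyclic order at its minima shows that the nonnegative zero-sum paths ("excursions")
   on S are counted by e_1(S), and k-tuples of them by e_k(S).
   Pulling out greedily the longest excursion after each retained step writes every excursion
   uniquely as a_1 L_1 a_2 L_2 ... a_n L_n, where the L_i are excursions and a_1 ... a_n is a
   positive tree permutation of its set A. With T counting the latter, this reads
   e_1(S) = sum over A of T(A) e_|A|(S - A), and convolution with e_(-1) yields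
   sum over A of T(A) e_(|A|-1)(S - A) = 0 for nonempty S, which determines T recursively.
   The claimed formula satisfies the same recursion: the coefficient of X(p) is, up to sign,
   an alternating sum over J <= p of a polynomial of degree |p| - 1 in the total size of J,
   a |p|-th finite difference, hence 0. *)

theory Submission
  imports Defs
begin

section \<open>Height paths read off lists, excursions, and the counting functions\<close>

definition wsum :: "('a \<Rightarrow> real) \<Rightarrow> 'a list \<Rightarrow> real" where
  "wsum wt xs = sum_list (map wt xs)"

lemma wsum_simps [simp]:
  "wsum wt [] = 0" "wsum wt (x # xs) = wt x + wsum wt xs"
  "wsum wt (xs @ ys) = wsum wt xs + wsum wt ys"
  by (simp_all add: wsum_def)

lemma wsum_distinct: "distinct xs \<Longrightarrow> wsum wt xs = sum wt (set xs)"
  by (simp add: wsum_def sum_list_distinct_conv_sum_set)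

text \<open>For large \<open>i\<close> the list \<open>take i xs\<close> is all of
  \<open>xs\<close>, so the unbounded quantifier ranges over just the prefixes. Height zero may
  recur inside, and the empty list counts.\<close>

definition excursion :: "('a \<Rightarrow> real) \<Rightarrow> 'a list \<Rightarrow> bool" where
  "excursion wt xs \<longleftrightarrow> (\<forall>i. 0 \<le> wsum wt (take i xs)) \<and> wsum wt xs = 0"

text \<open>Requiring \<open>p\<close> nonempty exempts factors at the start, since the list itself
  may be an excursion. As \<open>r\<close> may be empty, nonempty excursions as proper suffixes are
  excluded; for an excursion this forces positive interior heights.\<close>

definition irreducible_list :: "('a \<Rightarrow> real) \<Rightarrow> 'a list \<Rightarrow> bool" where
  "irreducible_list wt xs \<longleftrightarrow>
     (\<forall>p q r. xs = p @ q @ r \<longrightarrow> p \<noteq> [] \<longrightarrow> excursion wt q \<longrightarrow> q = [])"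

definition excursions :: "('a \<Rightarrow> real) \<Rightarrow> 'a set \<Rightarrow> 'a list set" where
  "excursions wt S = {xs \<in> permutations_of_set S. excursion wt xs}"

definition irreducible_excursions :: "('a \<Rightarrow> real) \<Rightarrow> 'a set \<Rightarrow> 'a list set" where
  "irreducible_excursions wt S = {xs \<in> excursions wt S. irreducible_list wt xs}"

text \<open>Entries may be empty; their disjointness is encoded in the distinctness of the
  concatenation.\<close>

definition excursion_tuples :: "('a \<Rightarrow> real) \<Rightarrow> nat \<Rightarrow> 'a set \<Rightarrow> 'a list list set" where
  "excursion_tuples wt k S =
     {Ls. length Ls = k \<and> (\<forall>L\<in>set Ls. excursion wt L) \<and> concat Ls \<in> permutations_of_set S}"

definition part_sum :: "('a \<Rightarrow> real) \<Rightarrow> int \<Rightarrow> 'a set \<Rightarrow> int" where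
  "part_sum wt t S = (\<Sum>p\<in>passport_partitions S wt. t ^ card p * int (partition_X p))"

section \<open>Convolution identities for weighted sums over zero-sum partitions\<close>

section \<open>Partitions into zero-sum blocks\<close>

lemma passport_partitions_iff:
  "p \<in> passport_partitions S wt \<longleftrightarrow> partition_on S p \<and> (\<forall>B\<in>p. sum wt B = 0)"
  unfolding passport_partitions_def subpassport_def partition_on_def by auto

lemma finite_passport_partitions: "finite S \<Longrightarrow> finite (passport_partitions S wt)"
  by (rule finite_subset[of _ "Pow (Pow S)"]) (auto simp: passport_partitions_iff partition_on_def)

lemma finite_passport_partition:
  "finite S \<Longrightarrow> p \<in> passport_partitions S wt \<Longrightarrow> finite p"
  by (auto simp: passport_partitions_iff intro: finite_elements)

lemma passport_partitions_empty: "passport_partitions {} wt = {{}}"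
  by (auto simp: passport_partitions_iff partition_on_def)

lemma part_sum_empty [simp]: "part_sum wt t {} = 1"
  by (simp add: part_sum_def passport_partitions_empty partition_X_def)

lemma passport_partitions_Un:
  assumes "q \<in> passport_partitions A wt" "r \<in> passport_partitions B wt" "A \<inter> B = {}"
  shows "q \<union> r \<in> passport_partitions (A \<union> B) wt" "q \<inter> r = {}"
proof -
  show "q \<union> r \<in> passport_partitions (A \<union> B) wt"
    using assms unfolding passport_partitions_iff partition_on_def
    by (auto intro: disjoint_union)
  show "q \<inter> r = {}"
  proof (rule equals0I)
    fix C assume "C \<in> q \<inter> r"
    then have "C \<subseteq> A" "C \<subseteq> B" "C \<noteq> {}"
      using assms by (auto simp: passport_partitions_iff partition_on_def)
    with assms(3) show False by blast
  qed
qed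

lemma passport_partitions_subset:
  assumes "p \<in> passport_partitions S wt" "J \<subseteq> p"
  shows "J \<in> passport_partitions (\<Union>J) wt"
  using assms unfolding passport_partitions_iff partition_on_def
  by (auto intro: pairwise_subset)

lemma Union_Diff_partition:
  assumes "p \<in> passport_partitions S wt" "J \<subseteq> p"
  shows "\<Union>(p - J) = S - \<Union>J"
proof -
  have S: "S = \<Union>p" and d: "disjoint p"
    using assms unfolding passport_partitions_iff partition_on_def by auto
  show ?thesis
    unfolding S using assms(2) disjointD[OF d] by (auto 4 3)
qed

text \<open>A partition of \<open>S\<close> with a marked subfamily \<open>J\<close> of blocks
  amounts to a set \<open>B\<close>, the union of \<open>J\<close>, with separate partitions of
  \<open>B\<close> and of \<open>S - B\<close>. An arbitrary \<open>F\<close> serves the additivity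
  law, the recursion at a point and the final cancellation alike.\<close>

lemma sum_passport_partitions_split:
  assumes "finite S"
  shows "(\<Sum>p\<in>passport_partitions S wt. \<Sum>J\<in>Pow p. F J (p - J)) =
    (\<Sum>B\<in>Pow S. \<Sum>q\<in>passport_partitions B wt. \<Sum>r\<in>passport_partitions (S - B) wt. F q r)"
proof -
  let ?PP = "\<lambda>B. passport_partitions B wt"
  have fin: "finite (?PP B)" if "B \<subseteq> S" for B
    using assms finite_passport_partitions finite_subset that by metis
  have "(\<Sum>p\<in>?PP S. \<Sum>J\<in>Pow p. F J (p - J)) = (\<Sum>(p, J)\<in>Sigma (?PP S) Pow. F J (p - J))"
    using assms finite_passport_partition[OF assms] fin by (subst sum.Sigma) auto
  also have "\<dots> = (\<Sum>(B, q, r)\<in>Sigma (Pow S) (\<lambda>B. ?PP B \<times> ?PP (S - B)). F q r)"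
  proof (rule sum.reindex_bij_witness
      [where i = "\<lambda>(B, q, r). (q \<union> r, q)" and j = "\<lambda>(p, J). (\<Union>J, J, p - J)"])
    fix x assume "x \<in> Sigma (?PP S) Pow"
    then obtain p J where x: "x = (p, J)" "p \<in> ?PP S" "J \<subseteq> p" by auto
    have "\<Union>J \<subseteq> S" using x by (auto simp: passport_partitions_iff partition_on_def)
    moreover have "p - J \<in> ?PP (S - \<Union>J)"
      using passport_partitions_subset[OF x(2), of "p - J"] Union_Diff_partition[OF x(2,3)] by auto
    ultimately show "(case x of (p, J) \<Rightarrow> (\<Union>J, J, p - J)) \<in> Sigma (Pow S) (\<lambda>B. ?PP B \<times> ?PP (S - B))"
      using x passport_partitions_subset[OF x(2,3)] by auto
    show "(case case x of (p, J) \<Rightarrow> (\<Union>J, J, p - J) of (B, q, r) \<Rightarrow> (q \<union> r, q)) = x"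
      using x by auto
    show "(case case x of (p, J) \<Rightarrow> (\<Union>J, J, p - J) of (B, q, r) \<Rightarrow> F q r) = (case x of (p, J) \<Rightarrow> F J (p - J))"
      using x by auto
  next
    fix y assume "y \<in> Sigma (Pow S) (\<lambda>B. ?PP B \<times> ?PP (S - B))"
    then obtain B q r where y: "y = (B, q, r)" "B \<subseteq> S" "q \<in> ?PP B" "r \<in> ?PP (S - B)" by auto
    note u = passport_partitions_Un[OF y(3,4)]
    have "B \<union> (S - B) = S" using y by auto
    then show "(case y of (B, q, r) \<Rightarrow> (q \<union> r, q)) \<in> Sigma (?PP S) Pow" using u(1) y by auto
    have "(q \<union> r) - q = r" using u(2) by auto
    moreover have "\<Union>q = B" using y by (auto simp: passport_partitions_iff partition_on_def)
    ultimately show "(case case y of (B, q, r) \<Rightarrow> (q \<union> r, q) of (p, J) \<Rightarrow> (\<Union>J, J, p - J)) = y"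
      using y by auto
  qed
  also have "\<dots> = (\<Sum>B\<in>Pow S. \<Sum>(q, r)\<in>?PP B \<times> ?PP (S - B). F q r)"
    using assms fin by (subst sum.Sigma) auto
  also have "\<dots> = (\<Sum>B\<in>Pow S. \<Sum>q\<in>?PP B. \<Sum>r\<in>?PP (S - B). F q r)"
    by (simp add: sum.cartesian_product)
  finally show ?thesis .
qed

lemma partition_X_split:
  assumes "finite p" "J \<subseteq> p"
  shows "partition_X p = partition_X J * partition_X (p - J)"
  unfolding partition_X_def using prod.subset_diff[OF assms(2,1)] by (simp add: mult.commute)

lemma prod_add_power_Pow:
  fixes s t :: "'b :: comm_ring_1"
  assumes "finite p"
  shows "(\<Sum>J\<in>Pow p. s ^ card J * t ^ card (p - J)) = (s + t) ^ card p"
  using prod_add[OF assms, of "\<lambda>_. s" "\<lambda>_. t"] by simp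

text \<open>\<open>partition_X\<close> is multiplicative over disjoint families of blocks, so after
  the split each \<open>p\<close> keeps its weight, times a binomial sum over the marked
  subfamilies.\<close>

lemma part_sum_add:
  assumes "finite S"
  shows "part_sum wt (s + t) S = (\<Sum>B\<in>Pow S. part_sum wt s B * part_sum wt t (S - B))"
proof -
  let ?F = "\<lambda>J K. (s ^ card J * int (partition_X J)) * (t ^ card K * int (partition_X K))"
  have "(\<Sum>B\<in>Pow S. part_sum wt s B * part_sum wt t (S - B)) =
      (\<Sum>B\<in>Pow S. \<Sum>q\<in>passport_partitions B wt. \<Sum>r\<in>passport_partitions (S - B) wt. ?F q r)"
    by (simp add: part_sum_def sum_product)
  also have "\<dots> = (\<Sum>p\<in>passport_partitions S wt. \<Sum>J\<in>Pow p. ?F J (p - J))"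
    using sum_passport_partitions_split[OF assms, of ?F] by simp
  also have "\<dots> = part_sum wt (s + t) S"
    unfolding part_sum_def
  proof (rule sum.cong[OF refl])
    fix p assume p: "p \<in> passport_partitions S wt"
    note f = finite_passport_partition[OF assms p]
    have "(\<Sum>J\<in>Pow p. ?F J (p - J)) = (\<Sum>J\<in>Pow p. s ^ card J * t ^ card (p - J) * int (partition_X p))"
      by (rule sum.cong[OF refl]) (simp add: partition_X_split[OF f])
    also have "\<dots> = (s + t) ^ card p * int (partition_X p)"
      by (simp add: prod_add_power_Pow[OF f] flip: sum_distrib_right)
    finally show "(\<Sum>J\<in>Pow p. ?F J (p - J)) = (s + t) ^ card p * int (partition_X p)" .
  qed
  finally show ?thesis by simp
qed

text \<open>Together with \<open>part_sum_empty\<close> this makes e_0 the unit of the convolution: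
  a partition of a nonempty set has a block, so 0 is raised to a positive power.\<close>

lemma part_sum_zero: "finite S \<Longrightarrow> S \<noteq> {} \<Longrightarrow> part_sum wt 0 S = 0"
  unfolding part_sum_def
proof (rule sum.neutral, rule ballI)
  fix p assume "finite S" "S \<noteq> {}" "p \<in> passport_partitions S wt"
  then have "finite p" "p \<noteq> {}" 
    using finite_passport_partition by (auto simp: passport_partitions_iff partition_on_def)
  then show "0 ^ card p * int (partition_X p) = 0" by (simp add: card_gt_0_iff)
qed

text \<open>Singles out the block around \<open>x\<close>; the other blocks partition its
  complement. The recursion is shaped to match \<open>card_excursions_point\<close>.\<close>

lemma part_sum_1_point:
  fixes S :: "'a set" and wt :: "'a \<Rightarrow> real"
  assumes "finite S" "x \<in> S"
  shows "part_sum wt 1 S =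
    (\<Sum>A\<in>{A \<in> Pow S. x \<in> A \<and> sum wt A = 0}. fact (card A - 1) * part_sum wt 1 (S - A))"
proof -
  \<comment> \<open>Marked subfamilies other than the single block around \<open>x\<close> get
    weight 0, so the general split becomes a sum over that block.\<close>
  define F where
    "F J K = (if \<exists>A. J = {A} \<and> x \<in> A then int (partition_X J) * int (partition_X K) else 0)" for J K :: "'a set set"
  have "part_sum wt 1 S = (\<Sum>p\<in>passport_partitions S wt. \<Sum>J\<in>Pow p. F J (p - J))"
    unfolding part_sum_def
  proof (rule sum.cong[OF refl])
    fix p assume p: "p \<in> passport_partitions S wt"
    note f = finite_passport_partition[OF assms(1) p]
    have S: "S = \<Union>p" and d: "disjoint p"
      using p unfolding passport_partitions_iff partition_on_def by auto
    obtain A where A: "A \<in> p" "x \<in> A" using assms(2) S by auto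
    have u: "B = A" if "B \<in> p" "x \<in> B" for B
      using disjointD[OF d] that A by blast
    have "F J (p - J) = 0" if "J \<in> Pow p - {{A}}" for J
    proof -
      have "\<not> (\<exists>B. J = {B} \<and> x \<in> B)" using u that by blast
      then show ?thesis unfolding F_def by (rule if_not_P)
    qed
    then have "(\<Sum>J\<in>Pow p. F J (p - J)) = (\<Sum>J\<in>{{A}}. F J (p - J))"
      using A f by (intro sum.mono_neutral_right) auto
    also have "\<dots> = int (partition_X p)"
      using A partition_X_split[OF f, of "{A}"] by (auto simp: F_def)
    finally show "1 ^ card p * int (partition_X p) = (\<Sum>J\<in>Pow p. F J (p - J))" by simp
  qed
  also have "\<dots> = (\<Sum>B\<in>Pow S. \<Sum>q\<in>passport_partitions B wt. \<Sum>r\<in>passport_partitions (S - B) wt. F q r)"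
    by (rule sum_passport_partitions_split[OF assms(1)])
  also have "\<dots> = (\<Sum>B\<in>Pow S. if x \<in> B \<and> sum wt B = 0 then fact (card B - 1) * part_sum wt 1 (S - B) else 0)"
  proof (rule sum.cong[OF refl])
    fix B assume B: "B \<in> Pow S"
    have fB: "finite (passport_partitions B wt)"
      using B assms(1) by (auto intro: finite_passport_partitions finite_subset)
    let ?G = "\<lambda>q. \<Sum>r\<in>passport_partitions (S - B) wt. F q r"
    have z: "?G q = 0" if "q \<in> passport_partitions B wt" "q \<noteq> {B} \<or> x \<notin> B" for q
    proof -
      have "\<Union>q = B" using that by (auto simp: passport_partitions_iff partition_on_def)
      then have n: "\<not> (\<exists>A. q = {A} \<and> x \<in> A)" using that(2) by auto
      have "F q r = 0" for r unfolding F_def by (rule if_not_P[OF n])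
      then show ?thesis by simp
    qed
    show "sum ?G (passport_partitions B wt) =
        (if x \<in> B \<and> sum wt B = 0 then fact (card B - 1) * part_sum wt 1 (S - B) else 0)"
    proof (cases "x \<in> B \<and> sum wt B = 0")
      case True
      then have "{B} \<in> passport_partitions B wt"
        by (auto simp: passport_partitions_iff intro: partition_on_space)
      then have "sum ?G (passport_partitions B wt) = sum ?G {{B}}"
        using z fB by (intro sum.mono_neutral_right) auto
      also have "\<dots> = fact (card B - 1) * part_sum wt 1 (S - B)"
        using True by (simp add: F_def partition_X_def part_sum_def sum_distrib_left)
      finally show ?thesis using True by simp
    next
      case False
      have "?G q = 0" if "q \<in> passport_partitions B wt" for q
      proof (cases "q = {B}")
        case True
        then show ?thesis using False that z by (auto simp: passport_partitions_iff)
      qed (use z that in auto)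
      then have "sum ?G (passport_partitions B wt) = 0" by (intro sum.neutral) blast
      then show ?thesis by (simp only: if_not_P[OF False])
    qed
  qed
  also have "\<dots> = (\<Sum>B\<in>{A \<in> Pow S. x \<in> A \<and> sum wt A = 0}. fact (card B - 1) * part_sum wt 1 (S - B))"
    using assms(1) by (intro sum.inter_filter[symmetric]) auto
  finally show ?thesis .
qed

text \<open>A \<open>card q\<close>-fold finite difference of a polynomial of degree
  \<open>k < card q\<close>. Inserting \<open>x\<close> takes one more difference, which lowers the
  degree.\<close>

lemma alternating_sum_power:
  fixes w :: "'b \<Rightarrow> int"
  assumes "finite q" "k < card q"
  shows "(\<Sum>J\<in>Pow q. (-1) ^ card J * (c + sum w J) ^ k) = 0"
  using assms
proof (induction q arbitrary: k rule: finite_induct)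
  case (insert x F)
  let ?f = "\<lambda>J k. (-1) ^ card J * (c + sum w J) ^ k"
  have fin: "finite J \<and> x \<notin> J" if "J \<in> Pow F" for J
    using that insert.hyps finite_subset by auto
  have inj: "inj_on (insert x) (Pow F)"
    using insert.hyps by (auto simp: inj_on_def)
  have "(\<Sum>J\<in>Pow (insert x F). ?f J k) = (\<Sum>J\<in>Pow F. ?f J k) + (\<Sum>J\<in>insert x ` Pow F. ?f J k)"
    unfolding Pow_insert using insert.hyps by (intro sum.union_disjoint) auto
  also have "(\<Sum>J\<in>insert x ` Pow F. ?f J k) = (\<Sum>J\<in>Pow F. ?f (insert x J) k)"
    using inj by (simp add: sum.reindex)
  also have "\<dots> = - (\<Sum>J\<in>Pow F. (-1) ^ card J * (w x + (c + sum w J)) ^ k)"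
    unfolding sum_negf[symmetric] by (rule sum.cong[OF refl]) (use fin in \<open>simp add: algebra_simps\<close>)
  also have "\<dots> = - (\<Sum>J\<in>Pow F. \<Sum>i\<le>k. of_nat (k choose i) * w x ^ i * ?f J (k - i))"
  proof -
    have "(-1) ^ card J * (w x + (c + sum w J)) ^ k =
        (\<Sum>i\<le>k. of_nat (k choose i) * w x ^ i * ?f J (k - i))" for J
      by (subst binomial_ring) (simp add: sum_distrib_left mult_ac)
    then show ?thesis by simp
  qed
  also have "\<dots> = - (\<Sum>i\<le>k. of_nat (k choose i) * w x ^ i * (\<Sum>J\<in>Pow F. ?f J (k - i)))"
    by (subst sum.swap) (simp add: sum_distrib_left)
  \<comment> \<open>For \<open>i > 0\<close> the exponent \<open>k - i\<close> is below
    \<open>card F\<close>, so the induction hypothesis applies. The surviving term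
    \<open>i = 0\<close> cancels the sum over the subsets without \<open>x\<close>.\<close>
  also have "\<dots> = - (\<Sum>i\<in>{0}. of_nat (k choose i) * w x ^ i * (\<Sum>J\<in>Pow F. ?f J (k - i)))"
  proof -
    have "(\<Sum>J\<in>Pow F. ?f J (k - i)) = 0" if "i \<in> {..k} - {0}" for i
      using insert that by (intro insert.IH) auto
    then show ?thesis
      by (intro arg_cong[where f = uminus] sum.mono_neutral_right) auto
  qed
  finally show ?case by simp
qed auto

section \<open>Excursions counted by zero-sum partitions, via the cycle lemma\<close>

section \<open>Counting excursions\<close>

lemma excursion_Nil [simp]: "excursion wt []"
  by (simp add: excursion_def)

lemma excursion_prefix_nonneg:
  assumes "excursion wt (xs @ ys)"
  shows "0 \<le> wsum wt xs"
proof -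
  have "0 \<le> wsum wt (take (length xs) (xs @ ys))" using assms unfolding excursion_def by blast
  then show ?thesis by simp
qed

lemma excursionI:
  assumes "\<And>ys zs. xs = ys @ zs \<Longrightarrow> 0 \<le> wsum wt ys" "wsum wt xs = 0"
  shows "excursion wt xs"
  unfolding excursion_def using assms by (metis append_take_drop_id)

lemma excursion_wsum: "excursion wt xs \<Longrightarrow> wsum wt xs = 0"
  by (simp add: excursion_def)

lemma excursion_append:
  assumes "excursion wt xs"
  shows "excursion wt (xs @ ys) \<longleftrightarrow> excursion wt ys"
proof
  assume "excursion wt ys"
  then show "excursion wt (xs @ ys)" using assms by (simp add: excursion_def)
next
  assume a: "excursion wt (xs @ ys)"
  show "excursion wt ys"
  proof (rule excursionI)
    fix us vs assume "ys = us @ vs"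
    then have "0 \<le> wsum wt (xs @ us)" using a by (intro excursion_prefix_nonneg[of _ _ vs]) simp
    then show "0 \<le> wsum wt us" using excursion_wsum[OF assms] by simp
  qed (use a assms in \<open>simp add: excursion_def\<close>)
qed

lemma excursions_iff:
  "xs \<in> excursions wt S \<longleftrightarrow> set xs = S \<and> distinct xs \<and> excursion wt xs"
  by (auto simp: excursions_def permutations_of_set_def)

lemma excursions_sum_zero: "xs \<in> excursions wt S \<Longrightarrow> sum wt S = 0"
  using wsum_distinct excursion_wsum by (metis excursions_iff)

lemma finite_excursions [intro]: "finite (excursions wt S)"
  unfolding excursions_def using finite_permutations_of_set by auto

text \<open>Every return of \<open>u\<close> to height zero ends an excursion prefix, so the
  condition says that \<open>x\<close> lies after the last return before the end.\<close>

definition last_excursion_lists :: "('a \<Rightarrow> real) \<Rightarrow> 'a \<Rightarrow> 'a set \<Rightarrow> 'a list set" where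
  "last_excursion_lists wt x A = {u \<in> excursions wt A. x \<in> A \<and>
     (\<forall>p q. u = p @ q \<longrightarrow> excursion wt p \<longrightarrow> x \<in> set p \<longrightarrow> q = [])}"

lemma shortest_excursion_prefix:
  assumes "excursion wt w" "x \<in> set w"
  obtains u v where "w = u @ v" "excursion wt u" "x \<in> set u"
    "\<And>p q. u = p @ q \<Longrightarrow> excursion wt p \<Longrightarrow> x \<in> set p \<Longrightarrow> q = []"
proof -
  let ?P = "\<lambda>k. k \<le> length w \<and> excursion wt (take k w) \<and> x \<in> set (take k w)"
  define k where "k = (LEAST k. ?P k)"
  have k: "?P k" unfolding k_def by (rule LeastI[of _ "length w"]) (use assms in simp)
  show thesis
  proof (rule that[of "take k w" "drop k w"])
    fix p q assume a: "take k w = p @ q" "excursion wt p" "x \<in> set p"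
    have l: "length p \<le> k" using a(1) k by (metis length_append length_take min.absorb2 le_add1)
    have "take (length p) w = take (length p) (take k w)" using l by (simp add: min_def)
    also have "\<dots> = p" using a(1) by simp
    finally have "?P (length p)" using a l k by simp
    then have "k \<le> length p" unfolding k_def by (rule Least_le)
    with a(1) k show "q = []" by (metis l le_antisym append_eq_conv_conj length_take min.absorb2 take_all_iff append_self_conv le_refl take_all)
  qed (use k in auto)
qed

text \<open>Cuts an excursion at its first return to zero after the step \<open>x\<close>. The left
  part belongs to \<open>last_excursion_lists\<close>, the right part is an arbitrary
  excursion.\<close>

lemma card_excursions_point:
  assumes "finite S" "x \<in> S"
  shows "card (excursions wt S) =
    (\<Sum>A\<in>Pow S. card (last_excursion_lists wt x A) * card (excursions wt (S - A)))"
proof -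
  let ?D = "Sigma (Pow S) (\<lambda>A. last_excursion_lists wt x A \<times> excursions wt (S - A))"
  have fin: "finite (last_excursion_lists wt x A)" for A
    by (rule finite_subset[OF _ finite_excursions[of wt A]]) (auto simp: last_excursion_lists_def)
  have "bij_betw (\<lambda>(A, u, v). u @ v) ?D (excursions wt S)"
  proof (rule bij_betwI')
    fix y z assume "y \<in> ?D" "z \<in> ?D"
    then obtain A u v A' u' v' where yz: "y = (A, u, v)" "z = (A', u', v')"
      and u: "u \<in> last_excursion_lists wt x A" and u': "u' \<in> last_excursion_lists wt x A'"
      by (auto simp del: Pow_iff)
    \<comment> \<open>Of two such prefixes of one list one extends the other, and minimality of the
      longer one forces equality.\<close>
    have *: "v = v' \<and> u = u'" if "u @ v = u' @ v'"
    proof -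
      from that obtain us where "u = u' @ us \<and> us @ v = v' \<or> u @ us = u' \<and> v = us @ v'"
        by (auto simp: append_eq_append_conv2)
      moreover from this have "us = []"
        using u u' unfolding last_excursion_lists_def excursions_iff by blast
      ultimately show ?thesis by auto
    qed
    moreover have "A = set u" "A' = set u'"
      using u u' by (auto simp: last_excursion_lists_def excursions_iff)
    ultimately show "((case y of (A, u, v) \<Rightarrow> u @ v) = (case z of (A, u, v) \<Rightarrow> u @ v)) \<longleftrightarrow> y = z"
      by (auto simp: yz)
  next
    fix y assume "y \<in> ?D"
    then obtain A u v where "y = (A, u, v)" "A \<subseteq> S" "u \<in> excursions wt A" "v \<in> excursions wt (S - A)"
      by (auto simp: last_excursion_lists_def)
    then show "(case y of (A, u, v) \<Rightarrow> u @ v) \<in> excursions wt S"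
      by (auto simp: excursions_iff excursion_append)
  next
    fix w assume w: "w \<in> excursions wt S"
    then obtain u v where uv: "w = u @ v" "excursion wt u" "x \<in> set u"
      "\<And>p q. u = p @ q \<Longrightarrow> excursion wt p \<Longrightarrow> x \<in> set p \<Longrightarrow> q = []"
      using shortest_excursion_prefix[of wt w x] assms(2) by (auto simp: excursions_iff)
    have "u \<in> last_excursion_lists wt x (set u)"
      using uv w by (auto simp: last_excursion_lists_def excursions_iff)
    moreover have "v \<in> excursions wt (S - set u)" "set u \<in> Pow S"
      using uv w by (auto simp: excursions_iff excursion_append)
    ultimately show "\<exists>y\<in>?D. w = (case y of (A, u, v) \<Rightarrow> u @ v)"
      using uv(1) by (intro bexI[of _ "(set u, u, v)"]) auto
  qed
  then have "card (excursions wt S) = card ?D" by (rule bij_betw_same_card[symmetric])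
  also have "\<dots> = (\<Sum>A\<in>Pow S. card (last_excursion_lists wt x A) * card (excursions wt (S - A)))"
    using assms(1) fin by (subst card_SigmaI) (auto simp: card_cartesian_product)
  finally show ?thesis .
qed

text \<open>The cycle lemma: read \<open>x\<close> and \<open>y\<close> cyclically and start at the
  first global minimum of the heights along \<open>y\<close>. Being a minimum makes all heights
  nonnegative; being the first one keeps them positive after \<open>x\<close> and before the
  end.\<close>

lemma rotation_to_last_excursion:
  assumes "wt x + wsum wt y = 0"
  obtains c d where "y = d @ c" "excursion wt (c @ x # d)"
    "\<And>p q. c @ x # d = p @ q \<Longrightarrow> excursion wt p \<Longrightarrow> x \<notin> set c \<Longrightarrow> x \<in> set p \<Longrightarrow> q = []"
proof -
  let ?f = "\<lambda>i. wsum wt (take i y)" and ?n = "length y"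
  let ?P = "\<lambda>i. i \<le> ?n \<and> (\<forall>j\<le>?n. ?f i \<le> ?f j)"
  have "\<exists>i. ?P i"
    using arg_min_if_finite[of "{..?n}" ?f] by (metis atMost_iff empty_iff finite_atMost le0 not_less)
  then have P: "?P (LEAST i. ?P i)" by (rule LeastI_ex)
  define i where "i = (LEAST i. ?P i)"
  have i: "i \<le> ?n" "\<And>j. ?f i \<le> ?f j" 
    using P unfolding i_def[symmetric] by (auto, metis nat_le_linear take_all order_refl)
  \<comment> \<open>Among several minima \<open>LEAST\<close> takes the first, which makes the
    inequality strict at earlier positions.\<close>
  have least: "?f i < ?f j" if "j < i" for j
  proof (rule ccontr)
    assume "\<not> ?f i < ?f j"
    then have "?P j" using i that by (meson le_trans less_imp_le not_less order_trans)
    then have "i \<le> j" unfolding i_def by (rule Least_le)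
    with that show False by simp
  qed
  define d c where "d = take i y" and "c = drop i y"
  have y: "y = d @ c" by (simp add: d_def c_def)
  have tot: "wt x + wsum wt d + wsum wt c = 0" using assms y by simp
  have min: "wsum wt d \<le> wsum wt e" if "y = e @ r" for e r
    using i(2)[of "length e"] that by (simp add: d_def)
  have smin: "wsum wt d < wsum wt e" if "d = e @ r" "r \<noteq> []" for e r
  proof -
    have "length e < i" using that i(1) by (metis d_def length_append length_take min.absorb2 length_greater_0_conv less_add_same_cancel1)
    moreover have "take (length e) y = e" using that y by simp
    ultimately show ?thesis using least[of "length e"] by (simp add: d_def)
  qed
  show thesis
  proof (rule that[OF y])
    show "excursion wt (c @ x # d)"
    proof (rule excursionI)
      fix ys zs assume "c @ x # d = ys @ zs"
      then consider r where "c = ys @ r" | "ys = c" | e r where "ys = c @ x # e" "d = e @ r"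
        by (auto simp: append_eq_append_conv2 Cons_eq_append_conv)
      then show "0 \<le> wsum wt ys"
      proof cases
        case 1
        then show ?thesis using min[of "d @ ys" r] y by simp
      next
        case 2
        then show ?thesis using min[of y "[]"] y by simp
      next
        case 3
        then show ?thesis using min[of e "r @ c"] y tot by simp
      qed
    qed (use tot in simp)
  next
    fix p q assume a: "c @ x # d = p @ q" "excursion wt p" "x \<notin> set c" "x \<in> set p"
    then obtain e where e: "p = c @ x # e" "d = e @ q"
      by (auto simp: append_eq_append_conv2 Cons_eq_append_conv)
    show "q = []"
    proof (rule ccontr)
      assume "q \<noteq> []"
      from smin[OF e(2) this] have "wsum wt d < wsum wt e" .
      with excursion_wsum[OF a(2)] e(1) tot show False by simp
    qed
  qed
qed

text \<open>Two cuts of one cyclic order differ by a segment \<open>r\<close>. Its height change is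
  nonnegative, as is that of \<open>c @ x # d'\<close>, and both add up to zero; so
  \<open>c @ x # d'\<close> is already an excursion containing \<open>x\<close>, and minimality
  empties \<open>r\<close>.\<close>

lemma rotation_to_last_excursion_unique:
  assumes "excursion wt (c @ x # d)" "excursion wt (c' @ x # d')" "d @ c = d' @ c'"
    and "\<And>p q. c @ x # d = p @ q \<Longrightarrow> excursion wt p \<Longrightarrow> x \<in> set p \<Longrightarrow> q = []"
    and "length d' \<le> length d"
  shows "d = d'"
proof -
  from assms(3,5) obtain r where r: "d = d' @ r" "c' = r @ c"
    by (auto simp: append_eq_append_conv2)
  have "0 \<le> wsum wt r"
    using assms(2) r(2) by (intro excursion_prefix_nonneg[of _ _ "c @ x # d'"]) simp
  moreover have "wsum wt (c @ x # d') + wsum wt r = 0"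
    using excursion_wsum[OF assms(1)] r by simp
  moreover have pre: "0 \<le> wsum wt ys" if "c @ x # d' = ys @ zs" for ys zs
    using assms(1) r that by (intro excursion_prefix_nonneg[of _ _ "zs @ r"]) (metis append.assoc append_Cons)
  moreover have "0 \<le> wsum wt (c @ x # d')" using pre[of _ "[]"] by simp
  ultimately have "excursion wt (c @ x # d')" by (intro excursionI) auto
  then have "r = []" using r by (intro assms(4)[of "c @ x # d'"]) auto
  then show ?thesis using r by simp
qed

text \<open>Deleting \<open>x\<close> from the cyclic order leaves an arbitrary list of the other
  elements, and each such list comes from exactly one cut; hence the factorial of
  \<open>card A - 1\<close>.\<close>

lemma card_last_excursion_lists:
  assumes "finite A" "x \<in> A"
  shows "card (last_excursion_lists wt x A) = (if sum wt A = 0 then fact (card A - 1) else 0)"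
proof (cases "sum wt A = 0")
  case False
  then have "last_excursion_lists wt x A = {}"
    by (auto simp: last_excursion_lists_def dest: excursions_sum_zero)
  then show ?thesis using False by simp
next
  case True
  \<comment> \<open>\<open>?h\<close> sends \<open>c @ x # d\<close> to \<open>d @ c\<close>: it
    rotates \<open>x\<close> to the front and then drops it.\<close>
  let ?h = "\<lambda>u. tl (dropWhile (\<lambda>a. a \<noteq> x) u) @ takeWhile (\<lambda>a. a \<noteq> x) u"
  have h: "?h (c @ x # d) = d @ c" if "x \<notin> set c" for c d
  proof -
    have "dropWhile (\<lambda>a. a \<noteq> x) (c @ x # d) = x # d"
      using that by (subst dropWhile_append2) auto
    moreover have "takeWhile (\<lambda>a. a \<noteq> x) (c @ x # d) = c"
      using that by (subst takeWhile_append2) auto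
    ultimately show ?thesis by simp
  qed
  have split: "\<exists>c d. u = c @ x # d \<and> x \<notin> set c" if "u \<in> last_excursion_lists wt x A" for u
    using that split_list_first[of x u] by (auto simp: last_excursion_lists_def excursions_iff)
  have "bij_betw ?h (last_excursion_lists wt x A) (permutations_of_set (A - {x}))"
  proof (rule bij_betwI')
    fix u u' assume u: "u \<in> last_excursion_lists wt x A" "u' \<in> last_excursion_lists wt x A"
    obtain c d c' d' where s: "u = c @ x # d" "x \<notin> set c" "u' = c' @ x # d'" "x \<notin> set c'"
      using split u by metis
    have e: "excursion wt u" "excursion wt u'"
      and m: "\<And>p q. u = p @ q \<Longrightarrow> excursion wt p \<Longrightarrow> x \<in> set p \<Longrightarrow> q = []"
      and m': "\<And>p q. u' = p @ q \<Longrightarrow> excursion wt p \<Longrightarrow> x \<in> set p \<Longrightarrow> q = []"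
      using u by (auto simp: last_excursion_lists_def excursions_iff)
    have "d = d'" if *: "d @ c = d' @ c'"
    proof (cases "length d' \<le> length d")
      case True
      then show ?thesis using rotation_to_last_excursion_unique[of wt c x d c' d'] e m * s by blast
    next
      case False
      then show ?thesis using rotation_to_last_excursion_unique[of wt c' x d' c d] e m' * s by simp
    qed
    moreover have "?h u = d @ c" "?h u' = d' @ c'" using h s by auto
    ultimately show "(?h u = ?h u') \<longleftrightarrow> u = u'" using s(1,3) by (metis same_append_eq)
  next
    fix u assume u: "u \<in> last_excursion_lists wt x A"
    obtain c d where s: "u = c @ x # d" "x \<notin> set c" using split u by metis
    then show "?h u \<in> permutations_of_set (A - {x})"
      using u h[OF s(2)] by (auto simp: last_excursion_lists_def excursions_iff permutations_of_set_def)
  next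
    fix y assume y: "y \<in> permutations_of_set (A - {x})"
    then have y': "set y = A - {x}" "distinct y" by (auto simp: permutations_of_set_def)
    have "wt x + wsum wt y = 0"
      using True assms wsum_distinct[OF y'(2)] y'(1) by (simp add: sum.remove)
    then obtain c d where cd: "y = d @ c" "excursion wt (c @ x # d)"
      "\<And>p q. c @ x # d = p @ q \<Longrightarrow> excursion wt p \<Longrightarrow> x \<notin> set c \<Longrightarrow> x \<in> set p \<Longrightarrow> q = []"
      using rotation_to_last_excursion by metis
    have x: "x \<notin> set c" using y' cd(1) by auto
    have "c @ x # d \<in> last_excursion_lists wt x A"
      using cd x y' assms(2) by (auto simp: last_excursion_lists_def excursions_iff)
    then show "\<exists>u\<in>last_excursion_lists wt x A. y = ?h u"
      using h[OF x] cd(1) by metis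
  qed
  then have "card (last_excursion_lists wt x A) = card (permutations_of_set (A - {x}))"
    by (rule bij_betw_same_card)
  then show ?thesis using True assms by simp
qed

text \<open>Both sides obey one recursion over the zero-sum sets \<open>A\<close> around a fixed
  \<open>x\<close>, with \<open>card_last_excursion_lists\<close> supplying the weight of the
  block.\<close>

theorem card_excursions:
  assumes "finite S"
  shows "int (card (excursions wt S)) = part_sum wt 1 S"
  using assms
proof (induction S rule: finite_psubset_induct)
  case (psubset S)
  show ?case
  proof (cases "S = {}")
    case True
    have "excursions wt {} = {[]}" by (auto simp: excursions_iff)
    then show ?thesis using True by simp
  next
    case False
    then obtain x where x: "x \<in> S" by auto
    have "int (card (excursions wt S)) = 
        (\<Sum>A\<in>Pow S. int (card (last_excursion_lists wt x A)) * int (card (excursions wt (S - A))))"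
      by (simp add: card_excursions_point[OF psubset.hyps x])
    also have "\<dots> = (\<Sum>A\<in>Pow S. if x \<in> A \<and> sum wt A = 0 then fact (card A - 1) * part_sum wt 1 (S - A) else 0)"
    proof (rule sum.cong[OF refl])
      fix A assume A: "A \<in> Pow S"
      then have f: "finite A" using psubset.hyps finite_subset by auto
      show "int (card (last_excursion_lists wt x A)) * int (card (excursions wt (S - A))) =
        (if x \<in> A \<and> sum wt A = 0 then fact (card A - 1) * part_sum wt 1 (S - A) else 0)"
      proof (cases "x \<in> A")
        case True
        then have "S - A \<subset> S" using A by auto
        then show ?thesis using card_last_excursion_lists[OF f True, of wt] psubset.IH True by simp
      next
        case False
        then have "last_excursion_lists wt x A = {}" by (auto simp: last_excursion_lists_def)
        then show ?thesis using False by simp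
      qed
    qed
    also have "\<dots> = part_sum wt 1 S"
      unfolding part_sum_1_point[OF psubset.hyps x]
      using psubset.hyps by (intro sum.inter_filter[symmetric]) auto
    finally show ?thesis .
  qed
qed

lemma finite_excursion_tuples:
  assumes "finite S"
  shows "finite (excursion_tuples wt k S)"
proof (rule finite_subset)
  show "excursion_tuples wt k S \<subseteq> {Ls. set Ls \<subseteq> {L. set L \<subseteq> S \<and> distinct L} \<and> length Ls = k}"
    by (fastforce simp: excursion_tuples_def permutations_of_set_def distinct_concat_iff)
  show "finite {Ls. set Ls \<subseteq> {L. set L \<subseteq> S \<and> distinct L} \<and> length Ls = k}"
    using assms finite_lists_length_eq finite_subset_distinct by (metis (no_types, lifting) Collect_cong)
qed

lemma excursion_tuples_iff:
  "Ls \<in> excursion_tuples wt k S \<longleftrightarrow> length Ls = k \<and> (\<forall>L\<in>set Ls. excursion wt L) \<and>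
     set (concat Ls) = S \<and> distinct (concat Ls)"
  unfolding excursion_tuples_def permutations_of_set_def by blast

lemma card_excursion_tuples_Suc:
  assumes "finite S"
  shows "card (excursion_tuples wt (Suc k) S) =
    (\<Sum>B\<in>Pow S. card (excursions wt B) * card (excursion_tuples wt k (S - B)))"
proof -
  let ?D = "Sigma (Pow S) (\<lambda>B. excursions wt B \<times> excursion_tuples wt k (S - B))"
  have "bij_betw (\<lambda>(B, L, Ls). L # Ls) ?D (excursion_tuples wt (Suc k) S)"
  proof (rule bij_betw_byWitness[where f' = "\<lambda>Ls. (set (hd Ls), hd Ls, tl Ls)"])
    show "\<forall>y\<in>?D. (\<lambda>Ls. (set (hd Ls), hd Ls, tl Ls)) (case y of (B, L, Ls) \<Rightarrow> L # Ls) = y"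
      by (auto simp: excursions_iff)
    show "\<forall>Ls\<in>excursion_tuples wt (Suc k) S. (case (set (hd Ls), hd Ls, tl Ls) of (B, L, Ls) \<Rightarrow> L # Ls) = Ls"
      by (auto simp: excursion_tuples_iff length_Suc_conv)
    show "(\<lambda>(B, L, Ls). L # Ls) ` ?D \<subseteq> excursion_tuples wt (Suc k) S"
      by (auto simp: excursions_iff excursion_tuples_iff)
    show "(\<lambda>Ls. (set (hd Ls), hd Ls, tl Ls)) ` excursion_tuples wt (Suc k) S \<subseteq> ?D"
    proof (rule image_subsetI)
      fix Ls assume Ls: "Ls \<in> excursion_tuples wt (Suc k) S"
      then obtain L Ms where L: "Ls = L # Ms" by (auto simp: excursion_tuples_iff length_Suc_conv)
      show "(set (hd Ls), hd Ls, tl Ls) \<in> ?D"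
        using Ls unfolding L by (auto simp: excursions_iff excursion_tuples_iff)
    qed
  qed
  then have "card (excursion_tuples wt (Suc k) S) = card ?D"
    by (rule bij_betw_same_card[symmetric])
  also have "\<dots> = (\<Sum>B\<in>Pow S. card (excursions wt B) * card (excursion_tuples wt k (S - B)))"
    using assms
    by (subst card_SigmaI)
      (auto simp: card_cartesian_product intro!: finite_excursions finite_excursion_tuples)
  finally show ?thesis .
qed

text \<open>e_0 is the unit, and splitting off the first entry of a tuple is convolution with
  e_1.\<close>

lemma card_excursion_tuples:
  assumes "finite S"
  shows "int (card (excursion_tuples wt k S)) = part_sum wt (int k) S"
  using assms
proof (induction k arbitrary: S)
  case 0
  show ?case
  proof (cases "S = {}")
    case True
    then have "excursion_tuples wt 0 S = {[]}" by (auto simp: excursion_tuples_iff)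
    then show ?thesis using True by simp
  next
    case False
    then have "excursion_tuples wt 0 S = {}" by (auto simp: excursion_tuples_iff)
    then show ?thesis using part_sum_zero[OF 0 False, of wt] by simp
  qed
next
  case (Suc k)
  have "int (card (excursion_tuples wt (Suc k) S)) =
      (\<Sum>B\<in>Pow S. int (card (excursions wt B)) * int (card (excursion_tuples wt k (S - B))))"
    by (simp add: card_excursion_tuples_Suc[OF Suc.prems])
  also have "\<dots> = (\<Sum>B\<in>Pow S. part_sum wt 1 B * part_sum wt (int k) (S - B))"
  proof (rule sum.cong[OF refl])
    fix B assume "B \<in> Pow S"
    then have "finite B" "finite (S - B)" using Suc.prems finite_subset by auto
    then show "int (card (excursions wt B)) * int (card (excursion_tuples wt k (S - B))) =
        part_sum wt 1 B * part_sum wt (int k) (S - B)"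
      by (simp only: card_excursions Suc.IH)
  qed
  also have "\<dots> = part_sum wt (1 + int k) S" by (rule part_sum_add[OF Suc.prems, symmetric])
  finally show ?case by simp
qed

section \<open>Unique decomposition of a list into an irreducible skeleton and inserted
  excursions\<close>

section \<open>Weaving excursions into an irreducible list\<close>

text \<open>Each retained step is followed by its own insertion. \<open>map2\<close> truncates to
  the shorter list, hence the equal-length hypotheses below.\<close>

definition weave :: "'a list \<Rightarrow> 'a list list \<Rightarrow> 'a list" where
  "weave as Ls = concat (map2 (#) as Ls)"

lemma weave_simps [simp]:
  "weave [] Ls = []" "weave (a # as) (L # Ls) = a # L @ weave as Ls"
  by (simp_all add: weave_def)

lemma weave_append:
  "length as = length Ls \<Longrightarrow> weave (as @ bs) (Ls @ Ms) = weave as Ls @ weave bs Ms"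
  by (simp add: weave_def)

lemma weave_eq_Nil_iff: "length as = length Ls \<Longrightarrow> weave as Ls = [] \<longleftrightarrow> as = []"
  by (cases as; cases Ls) simp_all

lemma mset_weave: "length as = length Ls \<Longrightarrow> mset (weave as Ls) = mset (as @ concat Ls)"
  by (induction as Ls rule: list_induct2) simp_all

lemma wsum_weave:
  "length as = length Ls \<Longrightarrow> \<forall>L\<in>set Ls. excursion wt L \<Longrightarrow> wsum wt (weave as Ls) = wsum wt as"
  by (induction as Ls rule: list_induct2) (simp_all add: excursion_wsum)

text \<open>Compares the heights of the woven list with those of its skeleton: \<open>p\<close>
  collects the steps of \<open>as\<close> met within \<open>r\<close>. A partly traversed insertion
  cannot lower the height and a complete one leaves it unchanged, so each height of \<open>p\<close>
  recurs along \<open>r\<close>.\<close>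

lemma weave_prefix:
  assumes "length as = length Ls" "\<forall>L\<in>set Ls. excursion wt L" "weave as Ls = r @ s" "r \<noteq> []"
  shows "\<exists>p q. as = p @ q \<and> p \<noteq> [] \<and> wsum wt p \<le> wsum wt r \<and>
    (\<forall>p1 p2. p = p1 @ p2 \<longrightarrow> (\<exists>r1 r2. r = r1 @ r2 \<and> wsum wt r1 = wsum wt p1))"
  using assms
proof (induction as Ls arbitrary: r rule: list_induct2)
  case (Cons a as L Ls)
  obtain r' where r: "r = a # r'" "L @ weave as Ls = r' @ s"
    using Cons.prems by (cases r) auto
  have L: "excursion wt L" using Cons.prems by simp
  \<comment> \<open>Either \<open>r\<close> stops within or right after the first insertion, or it
    continues into the rest by a nonempty \<open>r''\<close>, as the induction hypothesis
    requires.\<close>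
  from r(2) consider t where "L = r' @ t" | r'' where "r' = L @ r''" "weave as Ls = r'' @ s" "r'' \<noteq> []"
  proof -
    from r(2) obtain us where us: "L = r' @ us \<or> L @ us = r' \<and> weave as Ls = us @ s"
      by (auto simp: append_eq_append_conv2)
    show thesis
    proof (cases "us = []")
      case True
      then show thesis using us that(1)[of "[]"] by auto
    next
      case False
      then show thesis using us that by metis
    qed
  qed
  then show ?case
  proof cases
    case 1
    have "\<exists>r1 r2. r = r1 @ r2 \<and> wsum wt r1 = wsum wt p1" if "[a] = p1 @ p2" for p1 p2
    proof -
      from that consider "p1 = []" | "p1 = [a]" by (auto simp: Cons_eq_append_conv)
      then show ?thesis
      proof cases
        case 1
        then show ?thesis by (intro exI[of _ "[]"] exI[of _ r]) simp
      next
        case 2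
        then show ?thesis using r(1) by (intro exI[of _ "[a]"] exI[of _ r']) simp
      qed
    qed
    moreover have "0 \<le> wsum wt r'" using excursion_prefix_nonneg[of wt r' t] L 1 by simp
    ultimately show ?thesis using r by (intro exI[of _ "[a]"] exI[of _ as]) auto
  next
    case 2
    from Cons.IH[OF _ 2(2,3)] Cons.prems obtain p q where pq: "as = p @ q" "p \<noteq> []" "wsum wt p \<le> wsum wt r''"
      and pre: "\<And>p1 p2. p = p1 @ p2 \<Longrightarrow> \<exists>r1 r2. r'' = r1 @ r2 \<and> wsum wt r1 = wsum wt p1"
      by auto
    have "\<exists>r1 r2. r = r1 @ r2 \<and> wsum wt r1 = wsum wt p1" if p1: "a # p = p1 @ p2" for p1 p2
    proof (cases p1)
      case Nil
      then show ?thesis by (intro exI[of _ "[]"] exI[of _ r]) simp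
    next
      case (Cons b p1')
      with p1 have "p = p1' @ p2" "b = a" by auto
      with pre obtain r1 r2 where "r'' = r1 @ r2" "wsum wt r1 = wsum wt p1'" by blast
      then show ?thesis using r 2 L Cons \<open>b = a\<close> excursion_wsum[OF L]
        by (intro exI[of _ "a # L @ r1"] exI[of _ r2]) simp
    qed
    then show ?thesis using pq r 2 excursion_wsum[OF L]
      by (intro exI[of _ "a # p"] exI[of _ q]) simp
  qed
qed simp

text \<open>Heights of \<open>as\<close> occur in the woven list at the ends of insertions, and by
  \<open>weave_prefix\<close> each height of the woven list is at least some height of
  \<open>as\<close>.\<close>

lemma excursion_weave:
  assumes "length as = length Ls" "\<forall>L\<in>set Ls. excursion wt L"
  shows "excursion wt (weave as Ls) \<longleftrightarrow> excursion wt as"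
proof
  assume e: "excursion wt (weave as Ls)"
  show "excursion wt as"
  proof (rule excursionI)
    fix ys zs assume as: "as = ys @ zs"
    let ?k = "length ys"
    have "weave as Ls = weave ys (take ?k Ls) @ weave zs (drop ?k Ls)"
      using weave_append[of ys "take ?k Ls" zs "drop ?k Ls"] as assms(1) by simp
    then have "0 \<le> wsum wt (weave ys (take ?k Ls))"
      using e excursion_prefix_nonneg by metis
    moreover have "\<forall>L\<in>set (take ?k Ls). excursion wt L"
      using assms(2) by (auto dest: in_set_takeD)
    ultimately show "0 \<le> wsum wt ys"
      using wsum_weave[of ys "take ?k Ls" wt] as assms(1) by simp
  qed (use excursion_wsum[OF e] wsum_weave[OF assms] in simp)
next
  assume e: "excursion wt as"
  show "excursion wt (weave as Ls)"
  proof (rule excursionI)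
    fix r s assume w: "weave as Ls = r @ s"
    show "0 \<le> wsum wt r"
    proof (cases "r = []")
      case False
      from weave_prefix[OF assms w False] obtain p q where "as = p @ q" "wsum wt p \<le> wsum wt r"
        by blast
      then show ?thesis using e excursion_prefix_nonneg[of wt p q] by simp
    qed simp
  qed (use excursion_wsum[OF e] wsum_weave[OF assms] in simp)
qed

text \<open>Applied to what follows an insertion, this says that the insertion was chosen as long as
  possible.\<close>

definition excursion_prefix_free :: "('a \<Rightarrow> real) \<Rightarrow> 'a list \<Rightarrow> bool" where
  "excursion_prefix_free wt xs \<longleftrightarrow> (\<forall>q r. xs = q @ r \<longrightarrow> excursion wt q \<longrightarrow> q = [])"

lemma irreducible_list_Nil [simp]: "irreducible_list wt []"
  by (simp add: irreducible_list_def)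

text \<open>A factor after a nonempty prefix starts either at the head of \<open>xs\<close> or
  later. Irreducibility thus becomes a recursive condition fit for list induction.\<close>

lemma irreducible_list_Cons:
  "irreducible_list wt (x # xs) \<longleftrightarrow> excursion_prefix_free wt xs \<and> irreducible_list wt xs"
proof
  assume i: "irreducible_list wt (x # xs)"
  have "q = []" if "xs = q @ r" "excursion wt q" for q r
    using i that unfolding irreducible_list_def by (metis append_Cons append_Nil list.distinct(1))
  moreover have "q = []" if "xs = p @ q @ r" "excursion wt q" for p q r
    using i that unfolding irreducible_list_def by (metis append_Cons list.distinct(1))
  ultimately show "excursion_prefix_free wt xs \<and> irreducible_list wt xs"
    unfolding irreducible_list_def excursion_prefix_free_def by blast
next
  assume a: "excursion_prefix_free wt xs \<and> irreducible_list wt xs"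
  show "irreducible_list wt (x # xs)"
    unfolding irreducible_list_def
  proof (intro allI impI)
    fix p q r assume "x # xs = p @ q @ r" "p \<noteq> []" "excursion wt q"
    then obtain p' where p': "xs = p' @ q @ r" by (cases p) auto
    show "q = []"
    proof (cases "p' = []")
      case True
      then have "xs = q @ r" using p' by simp
      then show ?thesis using a \<open>excursion wt q\<close> unfolding excursion_prefix_free_def by blast
    next
      case False
      then show ?thesis using a p' \<open>excursion wt q\<close> unfolding irreducible_list_def by blast
    qed
  qed
qed

text \<open>A nonempty excursion prefix of the woven list yields by \<open>weave_prefix\<close> a
  nonempty prefix of \<open>as\<close> with nonnegative heights and final height at most 0. In the
  other direction a prefix of \<open>as\<close> is woven with its own insertions.\<close>

lemma excursion_prefix_free_weave:
  assumes "length as = length Ls" "\<forall>L\<in>set Ls. excursion wt L"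
  shows "excursion_prefix_free wt (weave as Ls) \<longleftrightarrow> excursion_prefix_free wt as"
proof
  assume f: "excursion_prefix_free wt (weave as Ls)"
  show "excursion_prefix_free wt as"
    unfolding excursion_prefix_free_def
  proof (intro allI impI)
    fix q r assume as: "as = q @ r" and q: "excursion wt q"
    let ?k = "length q"
    have "weave as Ls = weave q (take ?k Ls) @ weave r (drop ?k Ls)"
      using weave_append[of q "take ?k Ls" r "drop ?k Ls"] as assms(1) by simp
    moreover have "excursion wt (weave q (take ?k Ls))"
      using excursion_weave[of q "take ?k Ls" wt] q as assms by (auto dest: in_set_takeD)
    ultimately have "weave q (take ?k Ls) = []" using f unfolding excursion_prefix_free_def by blast
    then show "q = []" using weave_eq_Nil_iff[of q "take ?k Ls"] as assms by simp
  qed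
next
  assume f: "excursion_prefix_free wt as"
  show "excursion_prefix_free wt (weave as Ls)"
    unfolding excursion_prefix_free_def
  proof (intro allI impI)
    fix r s assume w: "weave as Ls = r @ s" and r: "excursion wt r"
    show "r = []"
    proof (rule ccontr)
      assume ne: "r \<noteq> []"
      from weave_prefix[OF assms w ne] obtain p q where p: "as = p @ q" "p \<noteq> []" "wsum wt p \<le> wsum wt r"
        and pre: "\<And>p1 p2. p = p1 @ p2 \<Longrightarrow> \<exists>r1 r2. r = r1 @ r2 \<and> wsum wt r1 = wsum wt p1"
        by blast
      have nn: "0 \<le> wsum wt p1" if "p = p1 @ p2" for p1 p2
        using pre[OF that] r excursion_prefix_nonneg by metis
      have "wsum wt p = 0" using nn[of p "[]"] p(3) excursion_wsum[OF r] by simp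
      with nn have "excursion wt p" by (intro excursionI) auto
      then show False using f p(1,2) unfolding excursion_prefix_free_def by blast
    qed
  qed
qed

text \<open>One of \<open>L\<close> and \<open>M\<close> extends the other, and by
  \<open>excursion_append\<close> the difference is an excursion at the start of \<open>u\<close> or
  \<open>v\<close>, hence empty.\<close>

lemma longest_excursion_prefix_unique:
  assumes "L @ u = M @ v" "excursion wt L" "excursion wt M"
    "excursion_prefix_free wt u" "excursion_prefix_free wt v"
  shows "L = M \<and> u = v"
proof -
  from assms(1) obtain us where us: "L = M @ us \<and> us @ u = v \<or> L @ us = M \<and> u = us @ v"
    by (auto simp: append_eq_append_conv2)
  then have "excursion wt us" using assms(2,3) excursion_append by metis
  then have "us = []" using us assms(4,5) unfolding excursion_prefix_free_def by blast
  then show ?thesis using us by auto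
qed

lemma longest_excursion_prefix_exists:
  "\<exists>L u. xs = L @ u \<and> excursion wt L \<and> excursion_prefix_free wt u"
proof (induction xs rule: length_induct)
  case (1 xs)
  show ?case
  proof (cases "excursion_prefix_free wt xs")
    case True
    then show ?thesis by (intro exI[of _ "[]"] exI[of _ xs]) simp
  next
    case False
    then obtain q r where q: "xs = q @ r" "excursion wt q" "q \<noteq> []"
      unfolding excursion_prefix_free_def by blast
    then have "length r < length xs" by simp
    with 1 obtain L u where "r = L @ u" "excursion wt L" "excursion_prefix_free wt u" by blast
    then show ?thesis using q by (intro exI[of _ "q @ L"] exI[of _ u]) (simp add: excursion_append)
  qed
qed

text \<open>After the common head, both \<open>L\<close> and \<open>M\<close> are the longest
  excursion prefix of the tail, because irreducibility of the skeletons leaves no nonempty excursion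
  prefix in the rest.\<close>

lemma weave_irreducible_unique:
  assumes "length as = length Ls" "length bs = length Ms" "weave as Ls = weave bs Ms"
    "\<forall>L\<in>set Ls. excursion wt L" "\<forall>L\<in>set Ms. excursion wt L"
    "irreducible_list wt as" "irreducible_list wt bs"
  shows "as = bs \<and> Ls = Ms"
  using assms
proof (induction as Ls arbitrary: bs Ms rule: list_induct2)
  case Nil
  then have "bs = []" using weave_eq_Nil_iff[of bs Ms] by simp
  then show ?case using Nil by simp
next
  case (Cons a as L Ls)
  from Cons.prems obtain b bs' M Ms' where b: "bs = b # bs'" "Ms = M # Ms'"
    by (cases bs; cases Ms) auto
  have "L @ weave as Ls = M @ weave bs' Ms'" using Cons.prems b by simp
  then have "L = M \<and> weave as Ls = weave bs' Ms'"
    by (rule longest_excursion_prefix_unique[of _ _ _ _ wt])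
      (use Cons.prems Cons.hyps b in \<open>simp_all add: irreducible_list_Cons excursion_prefix_free_weave\<close>)
  moreover from this have "as = bs' \<and> Ls = Ms'"
    using Cons.prems b by (intro Cons.IH) (simp_all add: irreducible_list_Cons)
  ultimately show ?case using Cons.prems b by simp
qed

text \<open>The greedy decomposition: keep the first step, remove the longest excursion after it,
  recurse on the rest. It applies to any list; the skeleton of an excursion is an excursion by
  \<open>excursion_weave\<close>.\<close>

lemma weave_irreducible_exists:
  "\<exists>as Ls. length as = length Ls \<and> (\<forall>L\<in>set Ls. excursion wt L) \<and>
     irreducible_list wt as \<and> xs = weave as Ls"
proof (induction xs rule: length_induct)
  case (1 xs)
  show ?case
  proof (cases xs)
    case Nil
    then show ?thesis by (intro exI[of _ "[]"]) simp
  next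
    case (Cons x ys)
    obtain L u where u: "ys = L @ u" "excursion wt L" "excursion_prefix_free wt u"
      using longest_excursion_prefix_exists by blast
    then have "length u < length xs" using Cons by simp
    with 1 obtain as Ls where as: "length as = length Ls" "\<forall>L\<in>set Ls. excursion wt L"
      "irreducible_list wt as" "u = weave as Ls" by blast
    then show ?thesis using u Cons
      by (intro exI[of _ "x # as"] exI[of _ "L # Ls"])
        (simp add: irreducible_list_Cons excursion_prefix_free_weave)
  qed
qed

lemma irreducible_excursions_iff:
  "xs \<in> irreducible_excursions wt S \<longleftrightarrow>
     set xs = S \<and> distinct xs \<and> excursion wt xs \<and> irreducible_list wt xs"
  by (auto simp: irreducible_excursions_def excursions_iff)

lemma finite_irreducible_excursions: "finite (irreducible_excursions wt S)"
  unfolding irreducible_excursions_def by (rule finite_subset[OF _ finite_excursions[of wt S]]) auto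

text \<open>Weaving is the bijection; there is one slot per retained step, so the tuple of
  insertions has length \<open>card A\<close>.\<close>

lemma card_excursions_weave:
  assumes "finite S"
  shows "card (excursions wt S) =
    (\<Sum>A\<in>Pow S. card (irreducible_excursions wt A) * card (excursion_tuples wt (card A) (S - A)))"
proof -
  let ?D = "Sigma (Pow S) (\<lambda>A. irreducible_excursions wt A \<times> excursion_tuples wt (card A) (S - A))"
  have D: "length as = length Ls" "\<forall>L\<in>set Ls. excursion wt L" "irreducible_list wt as"
    "excursion wt as" "A = set as" "distinct as" "A \<union> set (concat Ls) = S" "distinct (as @ concat Ls)"
    if "(A, as, Ls) \<in> ?D" for A as Ls
    using that by (auto simp: irreducible_excursions_iff excursion_tuples_iff distinct_card)
  have "bij_betw (\<lambda>(A, as, Ls). weave as Ls) ?D (excursions wt S)"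
  proof (rule bij_betwI')
    fix y z assume yz: "y \<in> ?D" "z \<in> ?D"
    obtain A as Ls B bs Ms where e: "y = (A, as, Ls)" "z = (B, bs, Ms)"
      by (metis prod.collapse)
    note y = D[OF yz(1)[unfolded e]] and z = D[OF yz(2)[unfolded e]]
    show "((case y of (A, as, Ls) \<Rightarrow> weave as Ls) = (case z of (A, as, Ls) \<Rightarrow> weave as Ls)) \<longleftrightarrow> y = z"
      using weave_irreducible_unique[OF y(1) z(1) _ y(2) z(2) y(3) z(3)] y(5) z(5) e by auto
  next
    fix y assume yD: "y \<in> ?D"
    obtain A as Ls where e: "y = (A, as, Ls)" by (metis prod.collapse)
    note y = D[OF yD[unfolded e]]
    have m: "mset (weave as Ls) = mset (as @ concat Ls)" by (rule mset_weave[OF y(1)])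
    have "set (weave as Ls) = S" using mset_eq_setD[OF m] y by simp
    moreover have "distinct (weave as Ls)" using mset_eq_imp_distinct_iff[OF m] y by simp
    moreover have "excursion wt (weave as Ls)" using excursion_weave[OF y(1,2)] y by simp
    ultimately show "(case y of (A, as, Ls) \<Rightarrow> weave as Ls) \<in> excursions wt S"
      using e by (simp add: excursions_iff)
  next
    fix w assume w: "w \<in> excursions wt S"
    obtain as Ls where as: "length as = length Ls" "\<forall>L\<in>set Ls. excursion wt L"
      "irreducible_list wt as" "w = weave as Ls" using weave_irreducible_exists by blast
    have m: "mset w = mset (as @ concat Ls)" using mset_weave[OF as(1)] as(4) by simp
    have s: "set (as @ concat Ls) = S" and d: "distinct (as @ concat Ls)" and e: "excursion wt as"
      using mset_eq_setD[OF m] mset_eq_imp_distinct_iff[OF m] w excursion_weave[OF as(1,2)] as(4)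
      by (simp_all add: excursions_iff)
    have "set (concat Ls) = S - set as" using s d by auto
    then have "(set as, as, Ls) \<in> ?D"
      using s d e as by (auto simp: irreducible_excursions_iff excursion_tuples_iff distinct_card)
    then show "\<exists>y\<in>?D. w = (case y of (A, as, Ls) \<Rightarrow> weave as Ls)"
      using as(4) by (intro bexI[of _ "(set as, as, Ls)"]) auto
  qed
  then have "card (excursions wt S) = card ?D" by (rule bij_betw_same_card[symmetric])
  also have "\<dots> = (\<Sum>A\<in>Pow S. card (irreducible_excursions wt A) * card (excursion_tuples wt (card A) (S - A)))"
    using assms
    by (subst card_SigmaI)
      (auto simp: card_cartesian_product intro!: finite_irreducible_excursions finite_excursion_tuples)
  finally show ?thesis .
qed

section \<open>Inverting the convolution and cancelling by finite differences\<close>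

section \<open>Inversion\<close>

text \<open>Chains \<open>A \<subseteq> C \<subseteq> S\<close> are reindexed by \<open>A\<close>
  and \<open>D = C - A\<close>; this is associativity of the subset convolution.\<close>

lemma sum_Pow_Pow:
  assumes "finite S"
  shows "(\<Sum>C\<in>Pow S. \<Sum>A\<in>Pow C. f A (C - A) (S - C)) =
    (\<Sum>A\<in>Pow S. \<Sum>D\<in>Pow (S - A). f A D (S - A - D))"
proof -
  have fin: "finite (Pow C)" if "C \<subseteq> S" for C using assms finite_subset that by auto
  have "(\<Sum>C\<in>Pow S. \<Sum>A\<in>Pow C. f A (C - A) (S - C)) =
      (\<Sum>(C, A)\<in>Sigma (Pow S) Pow. f A (C - A) (S - C))"
    using assms fin by (subst sum.Sigma) auto
  also have "\<dots> = (\<Sum>(A, D)\<in>Sigma (Pow S) (\<lambda>A. Pow (S - A)). f A D (S - A - D))"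
  proof (rule sum.reindex_bij_witness
      [where i = "\<lambda>(A, D). (A \<union> D, A)" and j = "\<lambda>(C, A). (A, C - A)"])
    fix y assume "y \<in> Sigma (Pow S) Pow"
    then obtain C A where y: "y = (C, A)" "C \<subseteq> S" "A \<subseteq> C" by auto
    have "S - A - (C - A) = S - C" using y by auto
    then show "(case case y of (C, A) \<Rightarrow> (A, C - A) of (A, D) \<Rightarrow> f A D (S - A - D)) =
        (case y of (C, A) \<Rightarrow> f A (C - A) (S - C))" using y(1) by simp
  qed auto
  also have "\<dots> = (\<Sum>A\<in>Pow S. \<Sum>D\<in>Pow (S - A). f A D (S - A - D))"
    using assms by (subst sum.Sigma) auto
  finally show ?thesis .
qed

text \<open>Convolving the weave identity with e_(-1) turns e_1 into e_0 on one side and e_|A| into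
  e_(|A|-1) on the other.\<close>

lemma irreducible_excursions_convolution:
  assumes "finite S"
  shows "(\<Sum>A\<in>Pow S. int (card (irreducible_excursions wt A)) * part_sum wt (int (card A) - 1) (S - A)) =
    part_sum wt 0 S"
proof -
  let ?T = "\<lambda>A. int (card (irreducible_excursions wt A))"
  have e1: "part_sum wt 1 C = (\<Sum>A\<in>Pow C. ?T A * part_sum wt (int (card A)) (C - A))"
    if "C \<subseteq> S" for C
  proof -
    have C: "finite C" using assms that finite_subset by auto
    have "part_sum wt 1 C = int (card (excursions wt C))" using card_excursions[OF C] by simp
    also have "\<dots> = (\<Sum>A\<in>Pow C. ?T A * int (card (excursion_tuples wt (card A) (C - A))))"
      by (simp add: card_excursions_weave[OF C])
    also have "\<dots> = (\<Sum>A\<in>Pow C. ?T A * part_sum wt (int (card A)) (C - A))"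
      using C by (simp add: card_excursion_tuples)
    finally show ?thesis .
  qed
  have "part_sum wt 0 S = part_sum wt (1 + (-1)) S" by simp
  also have "\<dots> = (\<Sum>C\<in>Pow S. part_sum wt 1 C * part_sum wt (-1) (S - C))"
    by (rule part_sum_add[OF assms])
  also have "\<dots> = (\<Sum>C\<in>Pow S. \<Sum>A\<in>Pow C. ?T A * part_sum wt (int (card A)) (C - A) * part_sum wt (-1) (S - C))"
    by (rule sum.cong[OF refl]) (simp add: e1 sum_distrib_right)
  also have "\<dots> = (\<Sum>A\<in>Pow S. \<Sum>D\<in>Pow (S - A). ?T A * part_sum wt (int (card A)) D * part_sum wt (-1) (S - A - D))"
    by (rule sum_Pow_Pow[OF assms, of "\<lambda>A D E. ?T A * part_sum wt (int (card A)) D * part_sum wt (-1) E"])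
  also have "\<dots> = (\<Sum>A\<in>Pow S. ?T A * part_sum wt (int (card A) - 1) (S - A))"
  proof (rule sum.cong[OF refl])
    fix A
    have "part_sum wt (int (card A) + (-1)) (S - A) =
        (\<Sum>D\<in>Pow (S - A). part_sum wt (int (card A)) D * part_sum wt (-1) (S - A - D))"
      by (rule part_sum_add) (use assms in simp)
    then show "(\<Sum>D\<in>Pow (S - A). ?T A * part_sum wt (int (card A)) D * part_sum wt (-1) (S - A - D)) =
        ?T A * part_sum wt (int (card A) - 1) (S - A)"
      by (simp add: sum_distrib_left mult.assoc)
  qed
  finally show ?thesis by simp
qed

text \<open>The claimed formula with the signs absorbed in \<open>1 - int (card A)\<close>. On the
  empty set truncated subtraction gives exponent 0 and value 1, matching the one empty list.\<close>

definition tree_sum :: "('a \<Rightarrow> real) \<Rightarrow> 'a set \<Rightarrow> int" where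
  "tree_sum wt A =
     (\<Sum>p\<in>passport_partitions A wt. (1 - int (card A)) ^ (card p - 1) * int (partition_X p))"

text \<open>For a fixed partition \<open>p\<close> the two powers combine, up to sign, into the
  power with exponent \<open>card p - 1\<close> of an affine function of the total size of
  \<open>J\<close>. Its alternating sum over all \<open>J\<close> is a \<open>card p\<close>-fold
  difference and vanishes.\<close>

lemma tree_sum_convolution:
  fixes S :: "'a set"
  assumes "finite S" "S \<noteq> {}"
  shows "(\<Sum>A\<in>Pow S. tree_sum wt A * part_sum wt (int (card A) - 1) (S - A)) = 0"
proof -
  \<comment> \<open>The size of the union of \<open>J\<close>, written as a sum over blocks: the
    summand then depends on the two families alone, as the split requires.\<close>
  define a where "a J = (\<Sum>B\<in>J. int (card B))" for J :: "'a set set"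
  define F where "F J K = ((1 - a J) ^ (card J - 1) * int (partition_X J)) *
    ((a J - 1) ^ card K * int (partition_X K))" for J K :: "'a set set"
  have a: "int (card A) = a q" if "q \<in> passport_partitions A wt" "A \<subseteq> S" for A q
  proof -
    have q: "\<Union>q = A" "pairwise disjnt q" using that by (auto simp: passport_partitions_iff partition_on_def)
    have "card (\<Union>q) = sum card q"
      using q assms(1) that(2) by (intro card_Union_disjoint) (auto intro: finite_subset)
    then show ?thesis using q by (simp add: a_def)
  qed
  have "(\<Sum>A\<in>Pow S. tree_sum wt A * part_sum wt (int (card A) - 1) (S - A)) =
      (\<Sum>A\<in>Pow S. \<Sum>q\<in>passport_partitions A wt. \<Sum>r\<in>passport_partitions (S - A) wt. F q r)"
    unfolding tree_sum_def part_sum_def sum_product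
    by (intro sum.cong refl) (simp add: F_def a)
  also have "\<dots> = (\<Sum>p\<in>passport_partitions S wt. \<Sum>J\<in>Pow p. F J (p - J))"
    by (rule sum_passport_partitions_split[OF assms(1), symmetric])
  also have "\<dots> = 0"
  proof (rule sum.neutral, rule ballI)
    fix p assume p: "p \<in> passport_partitions S wt"
    have f: "finite p" by (rule finite_passport_partition[OF assms(1) p])
    have "p \<noteq> {}" using p assms(2) by (auto simp: passport_partitions_iff partition_on_def)
    then have c: "card p - 1 < card p" "0 < card p" using f by (auto simp: card_gt_0_iff)
    have "F J (p - J) = (-1) ^ card p * int (partition_X p) * ((-1) ^ card J * (1 + (\<Sum>B\<in>J. - int (card B))) ^ (card p - 1))"
      if J: "J \<in> Pow p" for J
    proof -
      have fJ: "finite J" and cJ: "card J \<le> card p" using f J finite_subset card_mono by auto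
      have cd: "card (p - J) = card p - card J" using fJ J by (simp add: card_Diff_subset)
      have s: "(-1 :: int) ^ (card p - card J) = (-1) ^ card p * (-1) ^ card J"
        using cJ by (simp add: minus_one_power_iff)
      have "(1 - a J) ^ (card J - 1) * (1 - a J) ^ (card p - card J) = (1 - a J) ^ (card p - 1)"
      \<comment> \<open>For empty \<open>J\<close> the exponent \<open>card J - 1\<close> is
        truncated to 0 and the exponents need not add up, but the base \<open>1 - a J\<close> is
        then 1.\<close>
      proof (cases "J = {}")
        case False
        then have "card J - 1 + (card p - card J) = card p - 1"
          using fJ cJ card_gt_0_iff[of J] by simp
        then show ?thesis by (simp flip: power_add)
      qed (simp add: a_def)
      moreover have "(a J - 1) ^ (card p - card J) = (-1) ^ (card p - card J) * (1 - a J) ^ (card p - card J)"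
        by (simp flip: power_mult_distrib)
      ultimately have "(1 - a J) ^ (card J - 1) * (a J - 1) ^ (card p - card J) =
          (-1) ^ card p * (-1) ^ card J * (1 - a J) ^ (card p - 1)"
        unfolding s by (simp add: mult_ac)
      moreover have "partition_X p = partition_X J * partition_X (p - J)"
        using J by (intro partition_X_split[OF f]) simp
      moreover have "1 + (\<Sum>B\<in>J. - int (card B)) = 1 - a J" by (simp add: a_def sum_negf)
      ultimately show ?thesis unfolding F_def cd by (simp add: mult_ac)
    qed
    then have "(\<Sum>J\<in>Pow p. F J (p - J)) = (-1) ^ card p * int (partition_X p) *
        (\<Sum>J\<in>Pow p. (-1) ^ card J * (1 + (\<Sum>B\<in>J. - int (card B))) ^ (card p - 1))"
      by (simp add: sum_distrib_left)
    then show "(\<Sum>J\<in>Pow p. F J (p - J)) = 0"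
      using alternating_sum_power[OF f c(1), of 1 "\<lambda>B. - int (card B)"] by simp
  qed
  finally show ?thesis .
qed

text \<open>Both sides satisfy one recursion: in the vanishing convolution the term
  \<open>A = S\<close> has coefficient 1, and the other terms involve proper subsets.\<close>

theorem card_irreducible_excursions:
  assumes "finite S"
  shows "int (card (irreducible_excursions wt S)) = tree_sum wt S"
  using assms
proof (induction S rule: finite_psubset_induct)
  case (psubset S)
  show ?case
  proof (cases "S = {}")
    case True
    have "irreducible_excursions wt {} = {[]}" by (auto simp: irreducible_excursions_iff)
    then show ?thesis using True
      by (simp add: tree_sum_def passport_partitions_empty partition_X_def)
  next
    case False
    let ?T = "\<lambda>A. int (card (irreducible_excursions wt A))"
    have *: "(\<Sum>A\<in>Pow S. f A * part_sum wt (int (card A) - 1) (S - A)) =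
        f S + (\<Sum>A\<in>Pow S - {S}. f A * part_sum wt (int (card A) - 1) (S - A))" for f
      using psubset.hyps by (subst sum.remove[of _ S]) auto
    have "(\<Sum>A\<in>Pow S. ?T A * part_sum wt (int (card A) - 1) (S - A)) = 0"
      using irreducible_excursions_convolution[OF psubset.hyps] part_sum_zero[OF psubset.hyps False] by simp
    then have "?T S + (\<Sum>A\<in>Pow S - {S}. ?T A * part_sum wt (int (card A) - 1) (S - A)) =
        tree_sum wt S + (\<Sum>A\<in>Pow S - {S}. tree_sum wt A * part_sum wt (int (card A) - 1) (S - A))"
      using tree_sum_convolution[OF psubset.hyps False, of wt] * by simp
    moreover have "(\<Sum>A\<in>Pow S - {S}. ?T A * part_sum wt (int (card A) - 1) (S - A)) =
        (\<Sum>A\<in>Pow S - {S}. tree_sum wt A * part_sum wt (int (card A) - 1) (S - A))"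
      by (rule sum.cong[OF refl]) (use psubset.IH in auto)
    ultimately show ?thesis by simp
  qed
qed


section \<open>Translation between cumulative sums and factors of lists\<close>

section \<open>Positive tree permutations as irreducible excursions\<close>

lemma wsum_take:
  "i \<le> length xs \<Longrightarrow> wsum wt (take i xs) = cumulative_sum wt xs i"
proof (induction i)
  case (Suc i)
  then have "wsum wt (take (Suc i) xs) = wsum wt (take i xs) + wt (xs ! i)"
    by (simp add: take_Suc_conv_app_nth)
  then show ?case using Suc by (simp add: cumulative_sum_def)
qed (simp add: cumulative_sum_def)

lemma wsum_take_drop:
  assumes "i \<le> j" "j \<le> length xs"
  shows "wsum wt (take (j - i) (drop i xs)) = cumulative_sum wt xs j - cumulative_sum wt xs i"
proof -
  have "take j xs = take i xs @ take (j - i) (drop i xs)"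
    using assms(1) take_add[of i "j - i" xs] by simp
  then have "wsum wt (take j xs) = wsum wt (take i xs) + wsum wt (take (j - i) (drop i xs))"
    by simp
  then show ?thesis using assms by (simp add: wsum_take)
qed

lemma excursion_take_drop_iff:
  assumes "i \<le> j" "j \<le> length xs"
  shows "excursion wt (take (j - i) (drop i xs)) \<longleftrightarrow>
    cumulative_sum wt xs i = cumulative_sum wt xs j \<and>
    (\<forall>m\<in>{i..j}. cumulative_sum wt xs i \<le> cumulative_sum wt xs m)"
proof -
  let ?H = "cumulative_sum wt xs"
  have t: "wsum wt (take l (take (j - i) (drop i xs))) = ?H (min (i + l) j) - ?H i" for l
  proof -
    have "min (i + l) j - i = min l (j - i)" using assms(1) by linarith
    then show ?thesis using wsum_take_drop[of i "min (i + l) j" xs wt] assms by simp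
  qed
  have "(\<forall>l. 0 \<le> ?H (min (i + l) j) - ?H i) \<longleftrightarrow> (\<forall>m\<in>{i..j}. ?H i \<le> ?H m)"
  proof (intro iffI allI ballI)
    fix m assume "\<forall>l. 0 \<le> ?H (min (i + l) j) - ?H i" "m \<in> {i..j}"
    then show "?H i \<le> ?H m" by (auto dest: spec[of _ "m - i"] simp: min_def)
  qed (use assms(1) in \<open>auto simp: min_def\<close>)
  then show ?thesis
    unfolding excursion_def t using wsum_take_drop[OF assms, of wt] by auto
qed

lemma irreducible_list_iff:
  "irreducible_list wt xs \<longleftrightarrow>
    (\<forall>i j. 1 \<le> i \<longrightarrow> i < j \<longrightarrow> j \<le> length xs \<longrightarrow> \<not> excursion wt (take (j - i) (drop i xs)))"
proof
  assume l: "irreducible_list wt xs"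
  show "\<forall>i j. 1 \<le> i \<longrightarrow> i < j \<longrightarrow> j \<le> length xs \<longrightarrow> \<not> excursion wt (take (j - i) (drop i xs))"
  proof (intro allI impI notI)
    fix i j assume ij: "1 \<le> i" "i < j" "j \<le> length xs" "excursion wt (take (j - i) (drop i xs))"
    have "xs = take i xs @ take (j - i) (drop i xs) @ drop (j - i) (drop i xs)"
      by (simp only: append_take_drop_id)
    moreover have "take i xs \<noteq> []" using ij by auto
    ultimately have "take (j - i) (drop i xs) = []"
      using l ij(4) unfolding irreducible_list_def by blast
    then show False using ij by simp
  qed
next
  assume r: "\<forall>i j. 1 \<le> i \<longrightarrow> i < j \<longrightarrow> j \<le> length xs \<longrightarrow> \<not> excursion wt (take (j - i) (drop i xs))"
  show "irreducible_list wt xs"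
    unfolding irreducible_list_def
  proof (intro allI impI)
    fix p q s assume a: "xs = p @ q @ s" "p \<noteq> []" "excursion wt q"
    show "q = []"
    proof (rule ccontr)
      assume "q \<noteq> []"
      with a(1,2) have "1 \<le> length p" "length p < length p + length q" "length p + length q \<le> length xs"
        by (auto simp: Suc_le_eq)
      then have "\<not> excursion wt (take (length p + length q - length p) (drop (length p) xs))"
        using r by blast
      then show False using a(1,3) by simp
    qed
  qed
qed

text \<open>With \<open>i = k - 1\<close> and \<open>j = l\<close>, tree condition (2) forbids the
  excursion factors that start at positive height. Conversely, a zero height strictly inside would
  begin an excursion suffix, so irreducibility gives positivity; condition (3) then holds as no
  height is negative.\<close>

lemma PT_plus_eq_irreducible_excursions:
  assumes "full_passport S wt" "S \<noteq> {}"
  shows "PT_plus S wt = irreducible_excursions wt S"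
proof -
  have "positive_permutation wt xs \<and> tree_permutation wt xs \<longleftrightarrow> excursion wt xs \<and> irreducible_list wt xs"
    if xs: "set xs = S" "distinct xs" for xs
  proof -
    let ?H = "cumulative_sum wt xs" and ?N = "length xs"
    have H0: "?H 0 = 0" by (simp add: cumulative_sum_def)
    have HN: "?H ?N = 0"
      using wsum_take[of ?N xs wt] wsum_distinct[OF xs(2), of wt] xs(1) assms(1)
      by (simp add: full_passport_def)
    have N: "1 \<le> ?N" using xs(1) assms(2) by (cases xs) auto
    have ne: "?H (Suc i) \<noteq> ?H i" if "Suc i \<le> ?N" for i
    proof -
      have "wt (xs ! i) \<noteq> 0" using that xs(1) assms(1) by (auto simp: full_passport_def)
      then show ?thesis by (simp add: cumulative_sum_def)
    qed
    have exc: "excursion wt xs \<longleftrightarrow> (\<forall>m\<le>?N. 0 \<le> ?H m)"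
      using excursion_take_drop_iff[of 0 ?N xs wt] H0 HN by auto
    have irr: "irreducible_list wt xs \<longleftrightarrow>
      (\<forall>i j. 1 \<le> i \<longrightarrow> i < j \<longrightarrow> j \<le> ?N \<longrightarrow> ?H i = ?H j \<longrightarrow> (\<exists>m\<in>{i..j}. ?H m < ?H i))"
      unfolding irreducible_list_iff using excursion_take_drop_iff[of _ _ xs wt]
      by (meson less_imp_le not_less)
    show ?thesis
    proof (intro iffI conjI)
      assume a: "positive_permutation wt xs \<and> tree_permutation wt xs"
      then have pos: "0 < ?H i" if "1 \<le> i" "i < ?N" for i
        using that by (auto simp: positive_permutation_def)
      show "excursion wt xs" unfolding exc
      proof (intro allI impI)
        fix m assume "m \<le> ?N"
        then consider "m = 0" | "m = ?N" | "1 \<le> m" "m < ?N" by linarith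
        then show "0 \<le> ?H m" by cases (use pos H0 HN in \<open>auto intro: less_imp_le\<close>)
      qed
      show "irreducible_list wt xs" unfolding irr
      proof (intro allI impI)
        fix i j assume ij: "1 \<le> i" "i < j" "j \<le> ?N" "?H i = ?H j"
        have p: "0 < ?H i" by (rule pos) (use ij in auto)
        \<comment> \<open>A single step changes the height since weights are nonzero. This settles
          \<open>j = Suc i\<close>, where no index lies between the ends.\<close>
        have "j \<noteq> Suc i" using ne[of i] ij by auto
        then have l: "Suc i < j" using ij by simp
        have "\<forall>k l. 1 \<le> k \<and> k < l \<and> l \<le> ?N \<and> ?H (k - 1) = ?H l \<and> ?H l > 0
           \<longrightarrow> Min (?H ` {k..l - 1}) < ?H (k - 1)"
          using a unfolding tree_permutation_def Let_def by blast
        from this[rule_format, of "Suc i" j] have "Min (?H ` {Suc i..j - 1}) < ?H i"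
          using l ij p by simp
        then have "\<exists>m\<in>{Suc i..j - 1}. ?H m < ?H i"
          using l by (subst (asm) Min_less_iff) auto
        then show "\<exists>m\<in>{i..j}. ?H m < ?H i" by (auto intro!: bexI)
      qed
    next
      assume a: "excursion wt xs \<and> irreducible_list wt xs"
      then have nn: "0 \<le> ?H m" if "m \<le> ?N" for m using exc that by simp
      have ex: "\<exists>m\<in>{i..j}. ?H m < ?H i" if "1 \<le> i" "i < j" "j \<le> ?N" "?H i = ?H j" for i j
        using a irr that by blast
      have pos: "0 < ?H i" if i: "1 \<le> i" "i < ?N" for i
      proof (rule ccontr)
        assume "\<not> 0 < ?H i"
        then have z: "?H i = 0" using nn[of i] i by simp
        \<comment> \<open>The suffix from \<open>i\<close> to the end would return to its starting
          height 0, so irreducibility makes it dip below 0.\<close>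
        then obtain m where "m \<le> ?N" "?H m < 0" using ex[of i ?N] i HN by auto
        then show False using nn[of m] by simp
      qed
      show "positive_permutation wt xs" using pos by (auto simp: positive_permutation_def)
      show "tree_permutation wt xs" unfolding tree_permutation_def Let_def
      proof (intro conjI allI impI)
        fix i assume "1 \<le> i \<and> i \<le> ?N - 1"
        then have "1 \<le> i" "i < ?N" using N by auto
        then show "?H i \<noteq> 0" using pos[of i] by simp
      next
        fix k l assume kl: "1 \<le> k \<and> k < l \<and> l \<le> ?N \<and> ?H (k - 1) = ?H l \<and> ?H l > 0"
        \<comment> \<open>\<open>k = 1\<close> would mean the starting height
          \<open>?H 0 = 0\<close>, which is not positive; so \<open>k - 1\<close> is at least 1, as
          irreducibility requires.\<close>
        then have "k - 1 \<noteq> 0" using H0 by (metis less_irrefl)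
        then have "1 \<le> k - 1" "k - 1 < l" using kl by linarith+
        with ex[of "k - 1" l] kl obtain m where m: "k - 1 \<le> m" "m \<le> l" "?H m < ?H (k - 1)"
          by (metis atLeastAtMost_iff)
        \<comment> \<open>At both ends the height equals \<open>?H (k - 1)\<close>, so the dip lies
          strictly between them, in the range of the minimum.\<close>
        then have "m \<noteq> k - 1" "m \<noteq> l" using kl by auto
        then have "m \<in> {k..l - 1}" using m kl by auto
        then show "Min (?H ` {k..l - 1}) < ?H (k - 1)"
          using m(3) by (subst Min_less_iff) auto
      next
        fix k l assume "1 \<le> k \<and> k < l \<and> l \<le> ?N \<and> ?H (k - 1) = ?H l \<and> ?H l < 0"
        then show "?H (k - 1) < Max (?H ` {k..l - 1})" using nn[of l] by simp
      qed
    qed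
  qed
  then show ?thesis
    by (intro set_eqI) (simp add: PT_plus_def irreducible_excursions_iff permutations_of_set_def, blast)
qed

theorem theorem3p14:
  fixes S :: "'a set" and wt :: "'a \<Rightarrow> real" and N :: nat
  assumes "full_passport S wt" and "card S = N" and "N \<ge> 2"
  shows "int (card (PT_plus S wt)) =
    (\<Sum>p\<in>passport_partitions S wt.
       (-1) ^ (card p - 1) * (int N - 1) ^ (card p - 1) * int (partition_X p))"
proof -
  have "finite S" "S \<noteq> {}" using assms by (auto simp: full_passport_def)
  then have "int (card (PT_plus S wt)) = tree_sum wt S"
    using PT_plus_eq_irreducible_excursions[OF assms(1)] card_irreducible_excursions by metis
  also have "\<dots> = (\<Sum>p\<in>passport_partitions S wt.
       (-1) ^ (card p - 1) * (int N - 1) ^ (card p - 1) * int (partition_X p))"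
    unfolding tree_sum_def by (simp add: assms(2) flip: power_mult_distrib)
  finally show ?thesis .
qed

end
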